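(* Let $V_\varepsilon$ be a smooth family of potentials on $\mathbb{R}^2$ as described in the context, with $V_0(0)=0$, $V_0'(0)=0$, $V_0''(0)$ positive definite with eigenvalues $\omega_{1,0}^2,\omega_{2,0}^2$ ($\omega_{1,0},\omega_{2,0}>0$), and in near Fermi resonance, i.e. $\omega_{2,0}=2\omega_{1,0}$. Let $\mu$ be the coefficient of $\mathrm{Re}(z_1^2\bar z_2)$ in the order-3 quantum $\varepsilon$-Birkhoff-Gustavson normal form of $-\frac{\hbar^2}{2}\Delta+V_\varepsilon$ (defined in the context). Expressed in terms of the original potential $V_0$, the coefficient $\mu$ is given by $$\mu=\frac{1}{8\sqrt2\,\omega_{1,0}^{3/2}(1+z^2)^{3/2}}\Big(z\,\partial^3_{x_1^3}V_0(0)+(1-2z^2)\,\partial^3_{x_1^2x_2}V_0(0)+(z^3-2z)\,\partial^3_{x_1x_2^2}V_0(0)+z^2\,\partial^3_{x_2^3}V_0(0)\Big)$$ with $$\omega_{1,0}=\frac{1}{\sqrt3}\Big[\big(\partial^2_{x_1^2}V_0(0)-\partial^2_{x_2^2}V_0(0)\big)^2+4\big(\partial^2_{x_1x_2}V_0(0)\big)^2\Big]^{1/4}$$ and $$z=\frac{2\,|\partial^2_{x_1x_2}V_0(0)|}{3\omega_{1,0}^2-\partial^2_{x_1^2}V_0(0)+\partial^2_{x_2^2}V_0(0)}.$$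
   Context: Setting: $V_\varepsilon$ is a smooth real confining potential on $\mathbb{R}^2$, growing at most polynomially, depending smoothly on a small real parameter $\varepsilon$, with a unique and non-degenerate minimum; for $\varepsilon=0$ the minimum is at the origin. One reduces $-\frac{\hbar^2}{2}\Delta+V_\varepsilon$ by translating the minimum to the origin, applying an orthogonal change of variables $U_\varepsilon$ (smooth in $\varepsilon$) which diagonalizes the Hessian modulo $\mathcal{O}(\varepsilon^\infty)$, with approximate eigenvalues $\omega_{1,\varepsilon}^2,\omega_{2,\varepsilon}^2$ smooth in $\varepsilon$, $\omega_{j,\varepsilon}=\omega_{j,0}+\varepsilon\omega_{j,1}+\mathcal{O}(\varepsilon^2)$, and rescaling the $j$-th coordinate by $\sqrt{\omega_{j,\varepsilon}}$. The resulting operator is the constant $\min V_\varepsilon$ plus a harmonic oscillator with frequencies $\omega_{j,\varepsilon}$ (up to $\mathcal{O}(\varepsilon^\infty\|x\|^2)$) plus a function $R_\varepsilon=\mathcal{O}(x^3)$. Normal form: write $z_j=x_j+i\xi_j$ and $H_{2,0}=\frac12(\omega_{1,0}|z_1|^2+\omega_{2,0}|z_2|^2)$. Give $x_j,\xi_j,\varepsilon$ degree 1 and $\hbar$ degree 2. The symbol of the reduced operator, minus the constant, is formally conjugate to $H_{2,0}+K_{3,\varepsilon}+$ (terms of degree at least 4), where $K_{3,\varepsilon}$ is homogeneous of degree 3, commutes with $H_{2,0}$ for the Weyl bracket, and equals $$K_{3,\varepsilon}=\frac{\omega_{1,1}}2\varepsilon|z_1|^2+\frac{\omega_{2,1}}2\varepsilon|z_2|^2+\mu\,\mathrm{Re}(z_1^2\bar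 z_2),\qquad \mu=\frac18\,\frac{\partial^3R_{3,0}}{\partial x_1^2\,\partial x_2}(0),$$ where $R_{3,0}$ is the homogeneous cubic part of the Taylor expansion of $R_0$ at $0$. Explicitly, at $\varepsilon=0$, in the reduced coordinates $y=(y_1,y_2)$, $$R_0(y)=V_0\Big(U_0\big(y_1/\sqrt{\omega_{1,0}},\,y_2/\sqrt{\omega_{2,0}}\big)^{T}\Big)-\frac{\omega_{1,0}}{2}y_1^2-\frac{\omega_{2,0}}{2}y_2^2,$$ where the columns of the orthogonal matrix $U_0$ are unit eigenvectors of $V_0''(0)$ for $\omega_{1,0}^2$ and $\omega_{2,0}^2$ respectively. In the formula for $\mu$ in the claim, $z$ (without index) is the real number defined there, and all derivatives of $V_0$ are taken in the original coordinates $(x_1,x_2)$.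
   Formalization: The formula for μ is proved with z replaced by −z when ∂²V_0/∂x_1∂x_2(0) < 0 (the printed one fails there), times the sign of the second entry of the second column of U_0 (μ flips with that column), and only when the denominator of z is nonzero. *)

theory Defs
  imports "HOL-Analysis.Analysis" "HOL-Library.Landau_Symbols"
begin

section \<open>Smooth functions and partial derivatives\<close>

text \<open>\<open>S\<close> is meant to be open.\<close>

fun Ck_on :: "nat \<Rightarrow> 'a::euclidean_space set \<Rightarrow> ('a \<Rightarrow> real) \<Rightarrow> bool" where
  "Ck_on 0 S f \<longleftrightarrow> continuous_on S f"
| "Ck_on (Suc k) S f \<longleftrightarrow>
     (\<forall>x\<in>S. f differentiable (at x)) \<and>
     (\<forall>b\<in>Basis. Ck_on k S (\<lambda>x. frechet_derivative f (at x) b))"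

definition smooth_on :: "'a::euclidean_space set \<Rightarrow> ('a \<Rightarrow> real) \<Rightarrow> bool" where
  "smooth_on S f \<longleftrightarrow> (\<forall>k. Ck_on k S f)"

definition pd :: "2 \<Rightarrow> (real^2 \<Rightarrow> real) \<Rightarrow> real^2 \<Rightarrow> real" where
  "pd i f x = frechet_derivative f (at x) (axis i 1)"

definition hessian :: "(real^2 \<Rightarrow> real) \<Rightarrow> real^2 \<Rightarrow> real^2^2" where
  "hessian f x = (\<chi> i j. pd i (pd j f) x)"


section \<open>The family of potentials and its reduction\<close>

text \<open>\<open>m \<epsilon>\<close> is the point at which \<open>V \<epsilon>\<close> attains its minimum.\<close>

definition potential_family ::
  "real \<Rightarrow> (real \<Rightarrow> real^2 \<Rightarrow> real) \<Rightarrow> (real \<Rightarrow> real^2) \<Rightarrow> bool" where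
  "potential_family \<epsilon>0 V m \<longleftrightarrow>
     \<epsilon>0 > 0 \<and>
     smooth_on ({-\<epsilon>0<..<\<epsilon>0} \<times> UNIV) (\<lambda>(\<epsilon>, x). V \<epsilon> x) \<and>
     (\<forall>\<epsilon>\<in>{-\<epsilon>0<..<\<epsilon>0}.
        filterlim (V \<epsilon>) at_top at_infinity \<and>
        (\<exists>C N. \<forall>x. \<bar>V \<epsilon> x\<bar> \<le> C * (1 + norm x) ^ N) \<and>
        (\<forall>x. x \<noteq> m \<epsilon> \<longrightarrow> V \<epsilon> (m \<epsilon>) < V \<epsilon> x) \<and>
        (\<forall>v. v \<noteq> 0 \<longrightarrow> 0 < v \<bullet> (hessian (V \<epsilon>) (m \<epsilon>) *v v))) \<and>
     m 0 = 0"

text \<open>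
  The filter \<open>nhds 0\<close> (rather than \<open>at 0\<close>) makes the \<open>O(\<epsilon>\<^sup>\<infinity>)\<close> error vanish at \<open>\<epsilon> = 0\<close>, so that
  the columns of \<open>U 0\<close> are exact eigenvectors.
\<close>

definition diagonalizes ::
  "real \<Rightarrow> (real \<Rightarrow> real^2 \<Rightarrow> real) \<Rightarrow> (real \<Rightarrow> real^2) \<Rightarrow> (real \<Rightarrow> real^2^2) \<Rightarrow> (real \<Rightarrow> real^2) \<Rightarrow> bool"
  where
  "diagonalizes \<epsilon>0 V m U \<omega> \<longleftrightarrow>
     (\<forall>i j. smooth_on {-\<epsilon>0<..<\<epsilon>0} (\<lambda>\<epsilon>. U \<epsilon> $ i $ j)) \<and>
     (\<forall>j. smooth_on {-\<epsilon>0<..<\<epsilon>0} (\<lambda>\<epsilon>. \<omega> \<epsilon> $ j)) \<and>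
     (\<forall>\<epsilon>\<in>{-\<epsilon>0<..<\<epsilon>0}. orthogonal_matrix (U \<epsilon>) \<and> (\<forall>j. 0 < \<omega> \<epsilon> $ j)) \<and>
     (\<forall>N i j. (\<lambda>\<epsilon>. (transpose (U \<epsilon>) ** hessian (V \<epsilon>) (m \<epsilon>) ** U \<epsilon>) $ i $ j
                     - (if i = j then (\<omega> \<epsilon> $ i)\<^sup>2 else 0))
               \<in> O[nhds 0](\<lambda>\<epsilon>. \<epsilon> ^ N))"

text \<open>The Weyl symbol of \<open>- (\<hbar>\<^sup>2/2) \<Delta> + W\<close>.\<close>

definition schroedinger_symbol :: "(real^2 \<Rightarrow> real) \<Rightarrow> real^2 \<Rightarrow> real^2 \<Rightarrow> real" where
  "schroedinger_symbol W x \<xi> = (norm \<xi>)\<^sup>2 / 2 + W x"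

text \<open>
  The change of variables \<open>x = m + U (y\<^sub>j / \<surd>\<omega>\<^sub>j)\<^sub>j\<close> acts on Weyl symbols by the affine symplectic map
  \<open>(y, \<eta>) \<mapsto> (m + U (y\<^sub>j / \<surd>\<omega>\<^sub>j)\<^sub>j, U (\<surd>\<omega>\<^sub>j \<eta>\<^sub>j)\<^sub>j)\<close>.
\<close>

definition reduced_symbol ::
  "(real \<Rightarrow> real^2 \<Rightarrow> real) \<Rightarrow> (real \<Rightarrow> real^2) \<Rightarrow> (real \<Rightarrow> real^2^2) \<Rightarrow> (real \<Rightarrow> real^2)
     \<Rightarrow> real \<Rightarrow> real^2 \<Rightarrow> real^2 \<Rightarrow> real" where
  "reduced_symbol V m U \<omega> \<epsilon> y \<eta> =
     schroedinger_symbol (V \<epsilon>)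
       (m \<epsilon> + U \<epsilon> *v (\<chi> j. y $ j / sqrt (\<omega> \<epsilon> $ j)))
       (U \<epsilon> *v (\<chi> j. sqrt (\<omega> \<epsilon> $ j) * \<eta> $ j))
     - V \<epsilon> (m \<epsilon>)"


section \<open>Formal Weyl symbols\<close>

text \<open>
  \<open>fseries\<close> is the space of formal power series in \<open>x\<^sub>1, x\<^sub>2, \<xi>\<^sub>1, \<xi>\<^sub>2, \<epsilon>, \<hbar>\<close> with complex coefficients;
  a series is the function mapping an exponent to its coefficient.
\<close>

datatype fvar = X1 | X2 | Xi1 | Xi2 | Eps | Hbar

type_synonym fseries = "(fvar \<Rightarrow> nat) \<Rightarrow> complex"

definition wdeg :: "(fvar \<Rightarrow> nat) \<Rightarrow> nat" where
  "wdeg \<alpha> = \<alpha> X1 + \<alpha> X2 + \<alpha> Xi1 + \<alpha> Xi2 + \<alpha> Eps + 2 * \<alpha> Hbar"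

definition ser_mult :: "fseries \<Rightarrow> fseries \<Rightarrow> fseries" where
  "ser_mult f g \<gamma> = (\<Sum>\<alpha> | \<alpha> \<le> \<gamma>. f \<alpha> * g (\<lambda>v. \<gamma> v - \<alpha> v))"

definition ser_deriv :: "fvar \<Rightarrow> fseries \<Rightarrow> fseries" where
  "ser_deriv v f \<gamma> = of_nat (Suc (\<gamma> v)) * f (\<gamma>(v := Suc (\<gamma> v)))"

text \<open>
  \<open>bidiff k f g\<close> applies the \<open>k\<close>-th power of the bidifferential operator
  \<open>\<Sum>\<^sub>j \<partial>\<^sub>x\<^sub>j \<otimes> \<partial>\<^sub>\<xi>\<^sub>j - \<partial>\<^sub>\<xi>\<^sub>j \<otimes> \<partial>\<^sub>x\<^sub>j\<close> to \<open>f \<otimes> g\<close> and multiplies the factors.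
\<close>

fun bidiff :: "nat \<Rightarrow> fseries \<Rightarrow> fseries \<Rightarrow> fseries" where
  "bidiff 0 f g = ser_mult f g"
| "bidiff (Suc k) f g = (\<lambda>\<gamma>.
       bidiff k (ser_deriv X1 f) (ser_deriv Xi1 g) \<gamma> - bidiff k (ser_deriv Xi1 f) (ser_deriv X1 g) \<gamma>
     + bidiff k (ser_deriv X2 f) (ser_deriv Xi2 g) \<gamma> - bidiff k (ser_deriv Xi2 f) (ser_deriv X2 g) \<gamma>)"

text \<open>
  The Moyal product \<open>\<Sum>\<^sub>k (\<i>\<hbar>/2)\<^sup>k / k! \<sqdot> bidiff k f g\<close>, the composition law of Weyl symbols
  (so \<open>x\<^sub>j\<close> and \<open>\<xi>\<^sub>j\<close> have bracket \<open>\<i>\<hbar>\<close>); multiplication by \<open>\<hbar>\<^sup>k\<close> is a shift of exponents.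
\<close>

definition weyl_prod :: "fseries \<Rightarrow> fseries \<Rightarrow> fseries" where
  "weyl_prod f g \<gamma> =
     (\<Sum>k\<le>\<gamma> Hbar. (\<i> / 2) ^ k / fact k * bidiff k f g (\<gamma>(Hbar := \<gamma> Hbar - k)))"

definition weyl_bracket :: "fseries \<Rightarrow> fseries \<Rightarrow> fseries" where
  "weyl_bracket f g \<gamma> = weyl_prod f g \<gamma> - weyl_prod g f \<gamma>"

text \<open>
  \<open>weyl_ad A f = \<i> \<hbar>\<^sup>-\<^sup>1 [A, f]\<close>. The bracket is divisible by \<open>\<hbar>\<close>, because the \<open>k = 0\<close> terms of the two
  Moyal products agree, so the shift of exponents loses nothing.
\<close>

definition weyl_ad :: "fseries \<Rightarrow> fseries \<Rightarrow> fseries" where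
  "weyl_ad A f \<gamma> = \<i> * weyl_bracket A f (\<gamma>(Hbar := Suc (\<gamma> Hbar)))"

text \<open>
  \<open>exp (\<i> \<hbar>\<^sup>-\<^sup>1 ad\<^sub>A) f\<close>. If \<open>A\<close> only has terms of degree at least 3, then \<open>weyl_ad A\<close> raises the degree,
  and only finitely many terms of each coefficient are nonzero.
\<close>

definition weyl_conj :: "fseries \<Rightarrow> fseries \<Rightarrow> fseries" where
  "weyl_conj A f \<gamma> = (\<Sum>n. ((weyl_ad A ^^ n) f) \<gamma> / fact n)"

text \<open>The formal Taylor series at the origin of a function of \<open>(\<epsilon>, x, \<xi>)\<close>, independent of \<open>\<hbar>\<close>.\<close>

definition taylor_series :: "(real \<Rightarrow> real^2 \<Rightarrow> real^2 \<Rightarrow> real) \<Rightarrow> fseries" where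
  "taylor_series p \<alpha> =
     (if \<alpha> Hbar = 0 then
        of_real ((deriv ^^ \<alpha> Eps) (\<lambda>\<epsilon>. (deriv ^^ \<alpha> X1) (\<lambda>x1. (deriv ^^ \<alpha> X2) (\<lambda>x2.
                 (deriv ^^ \<alpha> Xi1) (\<lambda>\<xi>1. (deriv ^^ \<alpha> Xi2) (\<lambda>\<xi>2.
                    p \<epsilon> (vector [x1, x2]) (vector [\<xi>1, \<xi>2])) 0) 0) 0) 0) 0
          / (fact (\<alpha> Eps) * fact (\<alpha> X1) * fact (\<alpha> X2) * fact (\<alpha> Xi1) * fact (\<alpha> Xi2)))
      else 0)"


section \<open>The normal form of order 3\<close>

definition zc :: "2 \<Rightarrow> real^2 \<Rightarrow> real^2 \<Rightarrow> complex" where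
  "zc j x \<xi> = Complex (x $ j) (\<xi> $ j)"

definition H2 :: "real^2 \<Rightarrow> fseries" where
  "H2 w = taylor_series (\<lambda>\<epsilon> x \<xi>. (w $ 1 * (cmod (zc 1 x \<xi>))\<^sup>2 + w $ 2 * (cmod (zc 2 x \<xi>))\<^sup>2) / 2)"

text \<open>\<open>H\<close> is formally conjugate to \<open>H2 w + K\<close> plus terms of degree at least 4.\<close>

definition is_normal_form3 :: "fseries \<Rightarrow> real^2 \<Rightarrow> fseries \<Rightarrow> bool" where
  "is_normal_form3 H w K \<longleftrightarrow>
     (\<forall>\<gamma>. K \<gamma> \<noteq> 0 \<longrightarrow> wdeg \<gamma> = 3) \<and>
     (\<forall>\<gamma>. weyl_bracket K (H2 w) \<gamma> = 0) \<and>
     (\<exists>A. (\<forall>\<gamma>. A \<gamma> \<noteq> 0 \<longrightarrow> 3 \<le> wdeg \<gamma>) \<and>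
          (\<forall>\<gamma>. wdeg \<gamma> \<le> 3 \<longrightarrow> weyl_conj A H \<gamma> = H2 w \<gamma> + K \<gamma>))"

text \<open>
  \<open>(\<nu>\<^sub>1/2) \<epsilon> |z\<^sub>1|\<^sup>2 + (\<nu>\<^sub>2/2) \<epsilon> |z\<^sub>2|\<^sup>2 + \<mu> Re (z\<^sub>1\<^sup>2 cnj z\<^sub>2)\<close>
\<close>

definition K3 :: "real \<Rightarrow> real \<Rightarrow> real \<Rightarrow> fseries" where
  "K3 \<nu>1 \<nu>2 \<mu> = taylor_series (\<lambda>\<epsilon> x \<xi>.
     \<nu>1 / 2 * \<epsilon> * (cmod (zc 1 x \<xi>))\<^sup>2 + \<nu>2 / 2 * \<epsilon> * (cmod (zc 2 x \<xi>))\<^sup>2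
     + \<mu> * Re ((zc 1 x \<xi>)\<^sup>2 * cnj (zc 2 x \<xi>)))"


section \<open>The closed formula\<close>

definition mu_formula :: "(real^2 \<Rightarrow> real) \<Rightarrow> real \<Rightarrow> real \<Rightarrow> real" where
  "mu_formula W w z =
     1 / (8 * sqrt 2 * w powr (3/2) * (1 + z\<^sup>2) powr (3/2)) *
     (z * pd 1 (pd 1 (pd 1 W)) 0 + (1 - 2 * z\<^sup>2) * pd 1 (pd 1 (pd 2 W)) 0
      + (z ^ 3 - 2 * z) * pd 1 (pd 2 (pd 2 W)) 0 + z\<^sup>2 * pd 2 (pd 2 (pd 2 W)) 0)"

end

theory Submission
  imports Defs
begin

text \<open>
  Only the coefficients without \<open>\<epsilon>\<close> and \<open>\<hbar>\<close> matter. On them \<open>weyl_ad A\<close> is minus the Poisson bracket with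
  \<open>A\<close>, which raises the degree, so in degree 3 the normal form reads \<open>H\<^sub>3 - {A\<^sub>3, H\<^sub>2} = K\<^sub>3\<close>. In Fermi
  resonance the coefficient of \<open>z\<^sub>1\<^sup>2 cnj z\<^sub>2\<close> vanishes on the image of the bracket with \<open>H\<^sub>2\<close>; reading it
  off on both sides expresses \<open>\<mu>\<close> by the third derivative of \<open>V 0\<close> along \<open>u\<^sub>1, u\<^sub>1, u\<^sub>2\<close>, where \<open>u\<^sub>j\<close> are
  the columns of \<open>U 0\<close>. As \<open>U 0\<close> diagonalizes the Hessian with eigenvalues \<open>\<omega>\<^sub>1\<^sup>2\<close> and \<open>4 \<omega>\<^sub>1\<^sup>2\<close>, one
  has \<open>u\<^sub>2 = s (\<zeta>, 1)\<close> and \<open>u\<^sub>1 = \<plusminus> s (1, - \<zeta>)\<close> with \<open>\<zeta> = 2 b / d\<close> and \<open>s\<^sup>2 (1 + \<zeta>\<^sup>2) = 1\<close>.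
\<close>

section \<open>Partial derivatives\<close>

lemma frechet_derivative_eq_pd:
  assumes "f differentiable (at x)"
  shows "frechet_derivative f (at x) v = v $ 1 * pd 1 f x + v $ 2 * pd 2 f x"
proof -
  have lin: "linear (frechet_derivative f (at x))"
    using assms by (rule linear_frechet_derivative)
  have "v = v $ 1 *\<^sub>R axis 1 1 + v $ 2 *\<^sub>R axis 2 1"
    by (simp add: vec_eq_iff forall_2 axis_def)
  then have "frechet_derivative f (at x) v
      = frechet_derivative f (at x) (v $ 1 *\<^sub>R axis 1 1 + v $ 2 *\<^sub>R axis 2 1)"
    by simp
  then show ?thesis
    by (simp add: linear_add[OF lin] linear_scale[OF lin] pd_def)
qed

lemma has_real_derivative_along_line:
  assumes "f differentiable (at (p + t *\<^sub>R v))"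
  shows "((\<lambda>t. f (p + t *\<^sub>R v)) has_real_derivative
           v $ 1 * pd 1 f (p + t *\<^sub>R v) + v $ 2 * pd 2 f (p + t *\<^sub>R v)) (at t)"
proof -
  have "(f has_derivative frechet_derivative f (at (p + t *\<^sub>R v))) (at (p + t *\<^sub>R v))"
    using assms by (simp add: frechet_derivative_works)
  moreover have "((\<lambda>t. p + t *\<^sub>R v) has_derivative (\<lambda>h. h *\<^sub>R v)) (at t)"
    by (auto intro!: derivative_eq_intros)
  ultimately have "((\<lambda>t. f (p + t *\<^sub>R v)) has_derivative
      (\<lambda>h. frechet_derivative f (at (p + t *\<^sub>R v)) (h *\<^sub>R v))) (at t)"
    using has_derivative_compose by blast
  moreover have "(\<lambda>h. frechet_derivative f (at (p + t *\<^sub>R v)) (h *\<^sub>R v))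
      = (*) (v $ 1 * pd 1 f (p + t *\<^sub>R v) + v $ 2 * pd 2 f (p + t *\<^sub>R v))"
    by (simp add: fun_eq_iff frechet_derivative_eq_pd[OF assms] algebra_simps)
  ultimately show ?thesis
    by (simp add: has_field_derivative_def)
qed

lemma Ck_on_pd:
  assumes "Ck_on (Suc k) UNIV f"
  shows "Ck_on k UNIV (pd i f)"
proof -
  have "axis i 1 \<in> (Basis :: (real^2) set)"
    by (auto simp: Basis_vec_def)
  then show ?thesis
    using assms by (auto simp: pd_def[abs_def])
qed

text \<open>The derivative of the slice in direction \<open>b\<close> is that of \<open>F\<close> in
  direction \<open>(0, b)\<close>, again a basis vector, so induction applies. This passes from
  joint smoothness in \<open>(\<epsilon>, x)\<close> to \<open>V 0\<close>.\<close>

lemma Ck_on_slice: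
  fixes F :: "'a::euclidean_space \<times> 'b::euclidean_space \<Rightarrow> real"
  assumes "Ck_on k (S \<times> UNIV) F" and "a \<in> S"
  shows "Ck_on k UNIV (\<lambda>x. F (a, x))"
  using assms(1)
proof (induction k arbitrary: F)
  case 0
  then have "continuous_on (S \<times> UNIV) F" by simp
  then have "continuous_on UNIV (F \<circ> (\<lambda>x. (a, x)))"
    using assms(2)
    by (intro continuous_on_compose) (auto intro!: continuous_intros elim: continuous_on_subset)
  then show ?case by (simp add: o_def)
next
  case (Suc k)
  have F': "(F has_derivative frechet_derivative F (at (a, x))) (at (a, x))" for x
    using Suc.prems assms(2) by (auto simp: frechet_derivative_works)
  have D: "((\<lambda>x. F (a, x)) has_derivative (\<lambda>h. frechet_derivative F (at (a, x)) (0, h))) (at x)" for x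
  proof -
    have "((\<lambda>x. (a, x)) has_derivative (\<lambda>h. (0, h))) (at x)"
      by (auto intro!: derivative_eq_intros)
    from has_derivative_compose[OF this F'] show ?thesis .
  qed
  have "Ck_on k UNIV (\<lambda>x. frechet_derivative (\<lambda>x. F (a, x)) (at x) b)" if "b \<in> Basis" for b
  proof -
    have "(0, b) \<in> (Basis :: ('a \<times> 'b) set)"
      using that by (auto simp: Basis_prod_def)
    then have "Ck_on k (S \<times> UNIV) (\<lambda>x. frechet_derivative F (at x) (0, b))"
      using Suc.prems by simp
    from Suc.IH[OF this] show ?thesis
      by (simp add: frechet_derivative_at[OF D, symmetric])
  qed
  moreover have "\<forall>x. (\<lambda>x. F (a, x)) differentiable (at x)"
    using D differentiable_def by blast
  ultimately show ?case by simp
qed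

text \<open>The mean value theorem is applied twice: in direction \<open>i\<close> to the increment
  of \<open>f\<close> along \<open>j\<close>, then in direction \<open>j\<close> to
  \<open>pd i f\<close>.\<close>

lemma second_difference_eq_mixed_pd:
  assumes f: "\<And>x. f differentiable (at x)" and fi: "\<And>x. pd i f differentiable (at x)" and "0 < h"
  obtains s r where "0 < s" "s < h" "0 < r" "r < h"
    "f (x + h *\<^sub>R axis i 1 + h *\<^sub>R axis j 1) - f (x + h *\<^sub>R axis i 1) - f (x + h *\<^sub>R axis j 1) + f x
       = h\<^sup>2 * pd j (pd i f) (x + s *\<^sub>R axis i 1 + r *\<^sub>R axis j 1)"
proof -
  have pd: "((\<lambda>t. g (p + t *\<^sub>R axis k 1)) has_real_derivative pd k g (p + t *\<^sub>R axis k 1)) (at t)"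
    if "\<And>x. g differentiable (at x)" for g :: "real^2 \<Rightarrow> real" and p t and k :: 2
    using has_real_derivative_along_line[OF that, of p "axis k 1" t] exhaust_2[of k]
    by (auto simp: axis_def)
  define g where "g t = f (x + h *\<^sub>R axis j 1 + t *\<^sub>R axis i 1) - f (x + t *\<^sub>R axis i 1)" for t
  have "(g has_real_derivative
      pd i f (x + h *\<^sub>R axis j 1 + t *\<^sub>R axis i 1) - pd i f (x + t *\<^sub>R axis i 1)) (at t)" for t
    unfolding g_def by (intro DERIV_diff pd f)
  from MVT2[of 0 h g, OF \<open>0 < h\<close> this] obtain s where s: "0 < s" "s < h"
    and gs: "g h - g 0 = h * (pd i f (x + h *\<^sub>R axis j 1 + s *\<^sub>R axis i 1) - pd i f (x + s *\<^sub>R axis i 1))"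
    by auto
  from MVT2[of 0 h "\<lambda>t. pd i f (x + s *\<^sub>R axis i 1 + t *\<^sub>R axis j 1)", OF \<open>0 < h\<close> pd[OF fi]]
  obtain r where r: "0 < r" "r < h"
    and "pd i f (x + s *\<^sub>R axis i 1 + h *\<^sub>R axis j 1) - pd i f (x + s *\<^sub>R axis i 1)
      = h * pd j (pd i f) (x + s *\<^sub>R axis i 1 + r *\<^sub>R axis j 1)"
    by auto
  with gs have "g h - g 0 = h\<^sup>2 * pd j (pd i f) (x + s *\<^sub>R axis i 1 + r *\<^sub>R axis j 1)"
    by (simp add: add_ac power2_eq_square)
  with s r show ?thesis
    by (intro that[of s r]) (auto simp: g_def algebra_simps)
qed

text \<open>The second difference is symmetric in \<open>i\<close> and \<open>j\<close>, so the two
  mixed derivatives share a value at suitable points arbitrarily near \<open>x\<close>; continuity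
  does the rest.\<close>

lemma mixed_pd_commute:
  assumes "Ck_on 2 UNIV f"
  shows "pd i (pd j f) x = pd j (pd i f) x"
proof (rule ccontr)
  assume neq: "pd i (pd j f) x \<noteq> pd j (pd i f) x"
  have C2: "Ck_on (Suc (Suc 0)) UNIV f"
    using assms by (simp add: numeral_2_eq_2)
  have f: "f differentiable (at x)" for x
    using C2 by simp
  have fk: "pd k f differentiable (at x)" for k x
    using Ck_on_pd[OF C2, of k] by simp
  have cont: "isCont (pd k (pd l f)) x" for k l
    using Ck_on_pd[OF Ck_on_pd[OF C2]] by (simp add: continuous_on_eq_continuous_at)
  \<comment> \<open>Half the gap: values within \<open>e\<close> of the two derivatives at
    \<open>x\<close> cannot coincide.\<close>
  define e where "e = dist (pd i (pd j f) x) (pd j (pd i f) x) / 2"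
  have "e > 0" using neq by (simp add: e_def)
  obtain d1 where d1: "d1 > 0" "\<And>y. dist y x < d1 \<Longrightarrow> dist (pd i (pd j f) y) (pd i (pd j f) x) < e"
    using cont[of i j] \<open>e > 0\<close> unfolding continuous_at_eps_delta by (auto simp: dist_commute)
  obtain d2 where d2: "d2 > 0" "\<And>y. dist y x < d2 \<Longrightarrow> dist (pd j (pd i f) y) (pd j (pd i f) x) < e"
    using cont[of j i] \<open>e > 0\<close> unfolding continuous_at_eps_delta by (auto simp: dist_commute)
  define h where "h = min d1 d2 / 2"
  have h: "0 < h" "2 * h \<le> d1" "2 * h \<le> d2"
    using d1(1) d2(1) by (auto simp: h_def)
  have near: "dist (x + s *\<^sub>R axis k 1 + r *\<^sub>R axis l 1) x < 2 * h"
    if "0 < s" "s < h" "0 < r" "r < h" for s r and k l :: 2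
  proof -
    have "norm (s *\<^sub>R axis k 1 + r *\<^sub>R axis l (1::real)) \<le> s + r"
      using that by (intro norm_triangle_le) simp
    with that show ?thesis by (simp add: dist_norm add.assoc)
  qed
  obtain s r where sr: "0 < s" "s < h" "0 < r" "r < h" and
    1: "f (x + h *\<^sub>R axis i 1 + h *\<^sub>R axis j 1) - f (x + h *\<^sub>R axis i 1) - f (x + h *\<^sub>R axis j 1) + f x
       = h\<^sup>2 * pd j (pd i f) (x + s *\<^sub>R axis i 1 + r *\<^sub>R axis j 1)"
    using second_difference_eq_mixed_pd[OF f fk h(1)] by blast
  obtain s' r' where sr': "0 < s'" "s' < h" "0 < r'" "r' < h" and
    2: "f (x + h *\<^sub>R axis j 1 + h *\<^sub>R axis i 1) - f (x + h *\<^sub>R axis j 1) - f (x + h *\<^sub>R axis i 1) + f x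
       = h\<^sup>2 * pd i (pd j f) (x + s' *\<^sub>R axis j 1 + r' *\<^sub>R axis i 1)"
    using second_difference_eq_mixed_pd[OF f fk h(1)] by blast
  have "h\<^sup>2 * pd j (pd i f) (x + s *\<^sub>R axis i 1 + r *\<^sub>R axis j 1)
      = h\<^sup>2 * pd i (pd j f) (x + s' *\<^sub>R axis j 1 + r' *\<^sub>R axis i 1)"
    unfolding 1[symmetric] 2[symmetric] by (simp add: add_ac)
  then have eq: "pd j (pd i f) (x + s *\<^sub>R axis i 1 + r *\<^sub>R axis j 1)
      = pd i (pd j f) (x + s' *\<^sub>R axis j 1 + r' *\<^sub>R axis i 1)"
    using h(1) by simp
  have "dist (pd j (pd i f) (x + s *\<^sub>R axis i 1 + r *\<^sub>R axis j 1)) (pd j (pd i f) x) < e"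
    using d2(2) near[OF sr, of i j] h by force
  moreover have "dist (pd i (pd j f) (x + s' *\<^sub>R axis j 1 + r' *\<^sub>R axis i 1)) (pd i (pd j f) x) < e"
    using d1(2) near[OF sr', of j i] h by force
  ultimately show False
    using dist_triangle3[of "pd i (pd j f) x" "pd j (pd i f) x"
        "pd i (pd j f) (x + s' *\<^sub>R axis j 1 + r' *\<^sub>R axis i 1)"]
    unfolding eq e_def by linarith
qed

text \<open>This expands the third differential of \<open>f\<close> at 0 on \<open>u, u, v\<close>.
  The nesting of \<open>deriv\<close> is the one that \<open>taylor_series\<close> produces for
  \<open>x1^2 x2\<close>.\<close>

lemma third_derivative_along_lines:
  assumes "Ck_on 3 UNIV f"
  shows "deriv (deriv (\<lambda>s. deriv (\<lambda>t. f (s *\<^sub>R u + t *\<^sub>R v)) 0)) 0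
    = (u$1)\<^sup>2 * v$1 * pd 1 (pd 1 (pd 1 f)) 0
      + ((u$1)\<^sup>2 * v$2 + 2 * u$1 * u$2 * v$1) * pd 1 (pd 1 (pd 2 f)) 0
      + ((u$2)\<^sup>2 * v$1 + 2 * u$1 * u$2 * v$2) * pd 1 (pd 2 (pd 2 f)) 0
      + (u$2)\<^sup>2 * v$2 * pd 2 (pd 2 (pd 2 f)) 0"
proof -
  have C3: "Ck_on (Suc (Suc (Suc 0))) UNIV f"
    using assms by (simp add: numeral_3_eq_3)
  note C2 = Ck_on_pd[OF C3] and C1 = Ck_on_pd[OF Ck_on_pd[OF C3]]
  have f: "f differentiable (at x)" "pd i f differentiable (at x)" "pd i (pd j f) differentiable (at x)"
    for x i j
    using C3 C2[of i] C1[of i j] by (simp_all del: Ck_on.simps(1))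
  \<comment> \<open>The summand \<open>0\<close> is kept so that the chain rule with
    \<open>p = 0\<close> matches syntactically.\<close>
  have 0: "deriv (\<lambda>t. f (s *\<^sub>R u + t *\<^sub>R v)) 0 = v$1 * pd 1 f (0 + s *\<^sub>R u) + v$2 * pd 2 f (0 + s *\<^sub>R u)"
    for s
    using DERIV_imp_deriv[OF has_real_derivative_along_line[OF f(1), of "s *\<^sub>R u" v 0]] by simp
  note line = has_real_derivative_along_line[where p = 0 and v = u]
  have 1: "deriv (\<lambda>s. v$1 * pd 1 f (0 + s *\<^sub>R u) + v$2 * pd 2 f (0 + s *\<^sub>R u))
     = (\<lambda>s. v$1 * (u$1 * pd 1 (pd 1 f) (0 + s *\<^sub>R u) + u$2 * pd 2 (pd 1 f) (0 + s *\<^sub>R u))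
          + v$2 * (u$1 * pd 1 (pd 2 f) (0 + s *\<^sub>R u) + u$2 * pd 2 (pd 2 f) (0 + s *\<^sub>R u)))"
    by (intro ext DERIV_imp_deriv DERIV_add DERIV_cmult line f)
  have 2: "deriv (\<lambda>s. v$1 * (u$1 * pd 1 (pd 1 f) (0 + s *\<^sub>R u) + u$2 * pd 2 (pd 1 f) (0 + s *\<^sub>R u))
          + v$2 * (u$1 * pd 1 (pd 2 f) (0 + s *\<^sub>R u) + u$2 * pd 2 (pd 2 f) (0 + s *\<^sub>R u))) 0
     = v$1 * (u$1 * (u$1 * pd 1 (pd 1 (pd 1 f)) (0 + 0 *\<^sub>R u) + u$2 * pd 2 (pd 1 (pd 1 f)) (0 + 0 *\<^sub>R u))
          + u$2 * (u$1 * pd 1 (pd 2 (pd 1 f)) (0 + 0 *\<^sub>R u) + u$2 * pd 2 (pd 2 (pd 1 f)) (0 + 0 *\<^sub>R u)))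
          + v$2 * (u$1 * (u$1 * pd 1 (pd 1 (pd 2 f)) (0 + 0 *\<^sub>R u) + u$2 * pd 2 (pd 1 (pd 2 f)) (0 + 0 *\<^sub>R u))
          + u$2 * (u$1 * pd 1 (pd 2 (pd 2 f)) (0 + 0 *\<^sub>R u) + u$2 * pd 2 (pd 2 (pd 2 f)) (0 + 0 *\<^sub>R u)))"
    by (intro DERIV_imp_deriv DERIV_add DERIV_cmult line f)
  note deriv2 = 2[folded 1, folded 0]
  \<comment> \<open>The recursion tests continuity only at the last order; for the second
    derivatives it follows from their differentiability.\<close>
  have "Ck_on 2 UNIV f"
    using C3 C2 f by (simp add: numeral_2_eq_2 pd_def[abs_def] differentiable_imp_continuous_on
        differentiable_at_withinI differentiable_on_def)
  then have "pd 2 (pd 1 f) = pd 1 (pd 2 f)"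
    using mixed_pd_commute by blast
  moreover have "pd 2 (pd 1 (pd i f)) x = pd 1 (pd 2 (pd i f)) x" for i x
    using mixed_pd_commute C2[of i] by (simp add: numeral_2_eq_2)
  ultimately show ?thesis
    unfolding deriv2 by (simp add: power2_eq_square algebra_simps)
qed

section \<open>Taylor series of polynomials\<close>

lemma UNIV_fvar: "UNIV = {X1, X2, Xi1, Xi2, Eps, Hbar}"
  using fvar.exhaust by auto

lemma fun_fvar_eq_iff:
  "f = g \<longleftrightarrow> f X1 = g X1 \<and> f X2 = g X2 \<and> f Xi1 = g Xi1 \<and> f Xi2 = g Xi2 \<and> f Eps = g Eps \<and> f Hbar = g Hbar"
proof
  assume "f X1 = g X1 \<and> f X2 = g X2 \<and> f Xi1 = g Xi1 \<and> f Xi2 = g Xi2 \<and> f Eps = g Eps \<and> f Hbar = g Hbar"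
  then have "f v = g v" for v by (cases v) auto
  then show "f = g" by (rule ext)
qed simp

text \<open>Only monomials of degree exactly \<open>n\<close> survive at 0. Summing over an index
  set allows repeated exponents.\<close>

lemma higher_deriv_polynomial_0:
  fixes c :: "'i \<Rightarrow> real"
  assumes "finite I"
  shows "(deriv ^^ n) (\<lambda>x. \<Sum>i\<in>I. c i * x ^ e i) 0 = fact n * (\<Sum>i\<in>I. if e i = n then c i else 0)"
proof (induction n arbitrary: c e)
  case 0
  show ?case by (auto intro!: sum.cong simp: power_0_left)
next
  case (Suc n)
  have "deriv (\<lambda>x. \<Sum>i\<in>I. c i * x ^ e i) = (\<lambda>x. \<Sum>i\<in>I. (c i * real (e i)) * x ^ (e i - 1))"
    by (intro ext DERIV_imp_deriv) (auto intro!: derivative_eq_intros sum.cong)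
  then have "(deriv ^^ Suc n) (\<lambda>x. \<Sum>i\<in>I. c i * x ^ e i) 0
      = fact n * (\<Sum>i\<in>I. if e i - 1 = n then c i * real (e i) else 0)"
    by (simp add: funpow_Suc_right Suc.IH del: funpow.simps)
  \<comment> \<open>For \<open>e i = 0\<close> truncated subtraction may give
    \<open>e i - 1 = n\<close>, but then the factor \<open>real (e i)\<close> is zero.\<close>
  also have "\<dots> = fact (Suc n) * (\<Sum>i\<in>I. if e i = Suc n then c i else 0)"
    by (auto simp: sum_distrib_left intro!: sum.cong)
  finally show ?case .
qed

text \<open>The nested derivatives are evaluated from the inside out; each selects the monomials
  with the right exponent in its variable.\<close>

lemma taylor_series_polynomial:
  fixes c :: "'i \<Rightarrow> real" and e :: "'i \<Rightarrow> fvar \<Rightarrow> nat"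
  assumes "finite I"
    and p: "\<And>\<epsilon> x \<xi>. p \<epsilon> x \<xi> = (\<Sum>i\<in>I. c i * \<epsilon> ^ e i Eps * (x $ 1) ^ e i X1 * (x $ 2) ^ e i X2
                              * (\<xi> $ 1) ^ e i Xi1 * (\<xi> $ 2) ^ e i Xi2)"
    and Hbar: "\<And>i. i \<in> I \<Longrightarrow> e i Hbar = 0"
  shows "taylor_series p \<gamma> = of_real (\<Sum>i\<in>I. if e i = \<gamma> then c i else 0)"
proof -
  note D = higher_deriv_polynomial_0[OF assms(1)]
  define F where "F = (fact (\<gamma> Eps) * fact (\<gamma> X1) * fact (\<gamma> X2) * fact (\<gamma> Xi1) * fact (\<gamma> Xi2) :: real)"
  \<comment> \<open>As a factor, the indicator keeps every stage a sum of coefficients times powers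
    of the next variable.\<close>
  define b :: "fvar \<Rightarrow> 'i \<Rightarrow> real" where "b v i = (if e i v = \<gamma> v then 1 else 0)" for v i
  have D': "(deriv ^^ \<gamma> v) (\<lambda>x. \<Sum>i\<in>I. a i * x ^ e i v) 0 = (\<Sum>i\<in>I. fact (\<gamma> v) * b v i * a i)" for a v
    unfolding D sum_distrib_left b_def by (auto intro!: sum.cong)
  have 1: "(deriv ^^ \<gamma> Xi2) (\<lambda>\<xi>2. p \<epsilon> (vector [x1, x2]) (vector [\<xi>1, \<xi>2])) 0
    = (\<Sum>i\<in>I. (fact (\<gamma> Xi2) * b Xi2 i * (c i * \<epsilon> ^ e i Eps * x1 ^ e i X1 * x2 ^ e i X2)) * \<xi>1 ^ e i Xi1)"
    for \<epsilon> x1 x2 \<xi>1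
    unfolding p vector_2 D' by (simp add: mult_ac)
  have 2: "(deriv ^^ \<gamma> Xi1) (\<lambda>\<xi>1. (deriv ^^ \<gamma> Xi2) (\<lambda>\<xi>2. p \<epsilon> (vector [x1, x2]) (vector [\<xi>1, \<xi>2])) 0) 0
    = (\<Sum>i\<in>I. (fact (\<gamma> Xi1) * b Xi1 i * (fact (\<gamma> Xi2) * b Xi2 i * (c i * \<epsilon> ^ e i Eps * x1 ^ e i X1))) * x2 ^ e i X2)"
    for \<epsilon> x1 x2
    unfolding 1 D' by (simp add: mult_ac)
  have 3: "(deriv ^^ \<gamma> X2) (\<lambda>x2. (deriv ^^ \<gamma> Xi1) (\<lambda>\<xi>1. (deriv ^^ \<gamma> Xi2) (\<lambda>\<xi>2.
        p \<epsilon> (vector [x1, x2]) (vector [\<xi>1, \<xi>2])) 0) 0) 0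
    = (\<Sum>i\<in>I. (fact (\<gamma> X2) * b X2 i * (fact (\<gamma> Xi1) * b Xi1 i * (fact (\<gamma> Xi2) * b Xi2 i
         * (c i * \<epsilon> ^ e i Eps)))) * x1 ^ e i X1)"
    for \<epsilon> x1
    unfolding 2 D' by (simp add: mult_ac)
  have 4: "(deriv ^^ \<gamma> X1) (\<lambda>x1. (deriv ^^ \<gamma> X2) (\<lambda>x2. (deriv ^^ \<gamma> Xi1) (\<lambda>\<xi>1. (deriv ^^ \<gamma> Xi2) (\<lambda>\<xi>2.
        p \<epsilon> (vector [x1, x2]) (vector [\<xi>1, \<xi>2])) 0) 0) 0) 0
    = (\<Sum>i\<in>I. (fact (\<gamma> X1) * b X1 i * (fact (\<gamma> X2) * b X2 i * (fact (\<gamma> Xi1) * b Xi1 i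
         * (fact (\<gamma> Xi2) * b Xi2 i * c i)))) * \<epsilon> ^ e i Eps)"
    for \<epsilon>
    unfolding 3 D' by (simp add: mult_ac)
  have 5: "(deriv ^^ \<gamma> Eps) (\<lambda>\<epsilon>. (deriv ^^ \<gamma> X1) (\<lambda>x1. (deriv ^^ \<gamma> X2) (\<lambda>x2.
        (deriv ^^ \<gamma> Xi1) (\<lambda>\<xi>1. (deriv ^^ \<gamma> Xi2) (\<lambda>\<xi>2.
          p \<epsilon> (vector [x1, x2]) (vector [\<xi>1, \<xi>2])) 0) 0) 0) 0) 0
    = F * (\<Sum>i\<in>I. b Eps i * b X1 i * b X2 i * b Xi1 i * b Xi2 i * c i)"
    unfolding 4 D' sum_distrib_left F_def by (simp add: mult_ac)
  have "(\<Sum>i\<in>I. b Eps i * b X1 i * b X2 i * b Xi1 i * b Xi2 i * c i)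
      = (\<Sum>i\<in>I. if e i = \<gamma> then c i else 0)" if "\<gamma> Hbar = 0"
    using that Hbar by (intro sum.cong) (auto simp: b_def fun_fvar_eq_iff)
  moreover have "(\<Sum>i\<in>I. if e i = \<gamma> then c i else 0) = 0" if "\<gamma> Hbar \<noteq> 0"
    using that Hbar by (intro sum.neutral) (auto simp: fun_fvar_eq_iff)
  moreover have "F \<noteq> 0" by (simp add: F_def)
  ultimately show ?thesis
    unfolding taylor_series_def 5 F_def[symmetric] by (auto simp del: of_real_sum)
qed

lemma H2_eq:
  "H2 w = (\<lambda>\<gamma>. \<Sum>v\<in>{X1, X2, Xi1, Xi2}.
      if \<gamma> = (\<lambda>_. 0)(v := 2) then of_real (w $ (if v \<in> {X1, Xi1} then 1 else 2) / 2) else 0)"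
proof
  fix \<gamma>
  have "H2 w \<gamma> = of_real (\<Sum>v\<in>{X1, X2, Xi1, Xi2}.
      if (\<lambda>_. 0)(v := 2) = \<gamma> then w $ (if v \<in> {X1, Xi1} then 1 else 2) / 2 else 0)"
    unfolding H2_def
    by (rule taylor_series_polynomial) (auto simp: zc_def cmod_power2 algebra_simps add_divide_distrib)
  then show "H2 w \<gamma> = (\<Sum>v\<in>{X1, X2, Xi1, Xi2}.
      if \<gamma> = (\<lambda>_. 0)(v := 2) then of_real (w $ (if v \<in> {X1, Xi1} then 1 else 2) / 2) else 0)"
    by (auto simp: eq_commute[of _ \<gamma>])
qed

text \<open>\<open>case_fvar\<close> lists exponents in the order of the constructors. The values
  are those of \<open>x1^2 x2 - xi1^2 x2 + 2 x1 xi1 xi2\<close>, the real part of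
  \<open>z1^2 cnj z2\<close>.\<close>

lemma K3_cubic_coefficients:
  shows "K3 \<nu>1 \<nu>2 \<mu> (case_fvar 2 1 0 0 0 0) = of_real \<mu>"
    and "K3 \<nu>1 \<nu>2 \<mu> (case_fvar 0 1 2 0 0 0) = - of_real \<mu>"
    and "K3 \<nu>1 \<nu>2 \<mu> (case_fvar 1 0 1 1 0 0) = 2 * of_real \<mu>"
proof -
  define L where "L = [(\<nu>1 / 2, case_fvar 2 0 0 0 1 0), (\<nu>1 / 2, case_fvar 0 0 2 0 1 0),
    (\<nu>2 / 2, case_fvar 0 2 0 0 1 0), (\<nu>2 / 2, case_fvar 0 0 0 2 1 0),
    (\<mu>, case_fvar 2 1 0 0 0 0), (- \<mu>, case_fvar 0 1 2 0 0 0), (2 * \<mu>, case_fvar 1 0 1 1 0 (0::nat))]"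
  have Re: "Re ((zc 1 x \<xi>)\<^sup>2 * cnj (zc 2 x \<xi>))
      = (x $ 1)\<^sup>2 * x $ 2 - (\<xi> $ 1)\<^sup>2 * x $ 2 + 2 * x $ 1 * \<xi> $ 1 * \<xi> $ 2" for x \<xi>
    by (simp add: zc_def power2_eq_square algebra_simps)
  have cmod: "(cmod (zc j x \<xi>))\<^sup>2 = (x $ j)\<^sup>2 + (\<xi> $ j)\<^sup>2" for j x \<xi>
    by (simp add: zc_def cmod_power2)
  have I: "{..<7::nat} = {0, 1, 2, 3, 4, 5, 6}" by auto
  have "K3 \<nu>1 \<nu>2 \<mu> \<gamma> = of_real (\<Sum>i\<in>{..<7}. if snd (L ! i) = \<gamma> then fst (L ! i) else 0)" for \<gamma>
    unfolding K3_def Re cmod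
    by (rule taylor_series_polynomial) (auto simp: I L_def algebra_simps)
  then show "K3 \<nu>1 \<nu>2 \<mu> (case_fvar 2 1 0 0 0 0) = of_real \<mu>"
    "K3 \<nu>1 \<nu>2 \<mu> (case_fvar 0 1 2 0 0 0) = - of_real \<mu>"
    "K3 \<nu>1 \<nu>2 \<mu> (case_fvar 1 0 1 1 0 0) = 2 * of_real \<mu>"
    by (simp_all add: I L_def fun_fvar_eq_iff)
qed

section \<open>Weyl symbols at \<open>\<epsilon> = \<hbar> = 0\<close>\<close>

lemma finite_exponents_le: "finite {\<alpha> :: fvar \<Rightarrow> nat. \<alpha> \<le> \<gamma>}"
proof -
  have "finite (UNIV :: fvar set)" by (simp add: UNIV_fvar)
  then have "finite (PiE UNIV (\<lambda>v. {..\<gamma> v}))"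
    by (intro finite_PiE) auto
  then show ?thesis
    by (rule finite_subset[rotated]) (auto simp: le_fun_def PiE_def Pi_def)
qed

lemma ser_mult_commute: "ser_mult f g = ser_mult g f"
proof
  fix \<gamma>
  show "ser_mult f g \<gamma> = ser_mult g f \<gamma>"
    unfolding ser_mult_def
    by (rule sum.reindex_bij_witness[of _ "\<lambda>\<alpha> v. \<gamma> v - \<alpha> v" "\<lambda>\<alpha> v. \<gamma> v - \<alpha> v"])
      (auto simp: le_fun_def fun_eq_iff mult.commute)
qed

text \<open>In the coefficient of \<open>\<hbar>\<close> the \<open>k = 0\<close> terms of the two
  products cancel, and by antisymmetry the \<open>k = 1\<close> terms add up to \<open>\<i>\<close>
  times the Poisson bracket; the prefactor \<open>\<i>\<close> turns this into the minus
  sign.\<close>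

lemma weyl_ad_classical:
  assumes "\<gamma> Hbar = 0"
  shows "weyl_ad A f \<gamma> = - bidiff 1 A f \<gamma>"
proof -
  have [simp]: "\<gamma>(Hbar := 0) = \<gamma>"
    using assms by auto
  have "weyl_prod f g (\<gamma>(Hbar := 1)) = ser_mult f g (\<gamma>(Hbar := 1)) + \<i> / 2 * bidiff 1 f g \<gamma>" for f g
    by (simp add: weyl_prod_def)
  moreover have "bidiff 1 f A \<gamma> = - bidiff 1 A f \<gamma>"
    by (simp add: ser_mult_commute[of "ser_deriv _ A"])
  ultimately show ?thesis
    using assms by (simp add: weyl_ad_def weyl_bracket_def ser_mult_commute[of f A] algebra_simps
        del: bidiff.simps)
qed

section \<open>Order of vanishing at \<open>\<epsilon> = \<hbar> = 0\<close>\<close>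

text \<open>On the exponents tested, \<open>wdeg\<close> is the ordinary degree in
  \<open>x, \<xi>\<close>. Every exponent below such an exponent is again of this kind, so products
  and Poisson brackets respect the notion.\<close>

definition classical_order_ge :: "nat \<Rightarrow> fseries \<Rightarrow> bool" where
  "classical_order_ge n f \<longleftrightarrow> (\<forall>\<gamma>. \<gamma> Eps = 0 \<longrightarrow> \<gamma> Hbar = 0 \<longrightarrow> wdeg \<gamma> < n \<longrightarrow> f \<gamma> = 0)"

lemma wdeg_diff:
  assumes "\<alpha> \<le> \<gamma>"
  shows "wdeg \<gamma> = wdeg \<alpha> + wdeg (\<lambda>v. \<gamma> v - \<alpha> v)"
proof -
  have "\<alpha> v \<le> \<gamma> v" for v using assms by (simp add: le_fun_def)
  from this[of X1] this[of X2] this[of Xi1] this[of Xi2] this[of Eps] this[of Hbar]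
  show ?thesis by (simp add: wdeg_def)
qed

lemma classical_order_ge_mult:
  assumes "classical_order_ge m f" "classical_order_ge n g"
  shows "classical_order_ge (m + n) (ser_mult f g)"
  unfolding classical_order_ge_def
proof (intro allI impI)
  fix \<gamma> :: "fvar \<Rightarrow> nat"
  assume \<gamma>: "\<gamma> Eps = 0" "\<gamma> Hbar = 0" "wdeg \<gamma> < m + n"
  have "f \<alpha> * g (\<lambda>v. \<gamma> v - \<alpha> v) = 0" if "\<alpha> \<le> \<gamma>" for \<alpha>
  proof -
    have "\<alpha> Eps = 0" "\<alpha> Hbar = 0"
      using that \<gamma> by (metis le_fun_def le_zero_eq)+
    moreover have "wdeg \<alpha> < m \<or> wdeg (\<lambda>v. \<gamma> v - \<alpha> v) < n"
      using wdeg_diff[OF that] \<gamma>(3) by linarith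
    ultimately show ?thesis
      using assms \<gamma> by (auto simp: classical_order_ge_def)
  qed
  then show "ser_mult f g \<gamma> = 0"
    unfolding ser_mult_def by (intro sum.neutral) auto
qed

lemma classical_order_ge_deriv:
  assumes "classical_order_ge n f" "v \<in> {X1, X2, Xi1, Xi2}"
  shows "classical_order_ge (n - 1) (ser_deriv v f)"
  unfolding classical_order_ge_def
proof (intro allI impI)
  fix \<gamma> :: "fvar \<Rightarrow> nat"
  assume \<gamma>: "\<gamma> Eps = 0" "\<gamma> Hbar = 0" "wdeg \<gamma> < n - 1"
  define \<gamma>' where "\<gamma>' = \<gamma>(v := Suc (\<gamma> v))"
  have "wdeg \<gamma>' = Suc (wdeg \<gamma>)" "\<gamma>' Eps = 0" "\<gamma>' Hbar = 0"
    using assms(2) \<gamma>(1,2) by (auto simp: wdeg_def \<gamma>'_def)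
  then have "f \<gamma>' = 0"
    using assms(1) \<gamma>(3) by (simp add: classical_order_ge_def)
  then show "ser_deriv v f \<gamma> = 0"
    by (simp add: ser_deriv_def \<gamma>'_def)
qed

text \<open>The Poisson bracket differentiates each factor once, which leaves orders 2 and
  \<open>n - 1\<close>.\<close>

lemma classical_order_ge_weyl_ad:
  assumes "classical_order_ge 3 A" "classical_order_ge n f"
  shows "classical_order_ge (Suc n) (weyl_ad A f)"
proof -
  have "classical_order_ge (3 - 1 + (n - 1)) (ser_mult (ser_deriv u A) (ser_deriv v f))"
    if "u \<in> {X1, X2, Xi1, Xi2}" "v \<in> {X1, X2, Xi1, Xi2}" for u v
    using that assms by (intro classical_order_ge_mult classical_order_ge_deriv)
  \<comment> \<open>This weakening covers \<open>n = 0\<close>, where \<open>n - 1\<close> is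
    truncated and the order found is 2.\<close>
  then have "classical_order_ge (Suc n) (ser_mult (ser_deriv u A) (ser_deriv v f))"
    if "u \<in> {X1, X2, Xi1, Xi2}" "v \<in> {X1, X2, Xi1, Xi2}" for u v
    using that unfolding classical_order_ge_def by fastforce
  then show ?thesis
    by (simp add: classical_order_ge_def weyl_ad_classical)
qed

text \<open>The \<open>k\<close>-fold bracket has order at least \<open>n + k\<close>, so below
  degree \<open>n + 2\<close> the exponential series stops after its linear term.\<close>

lemma weyl_conj_classical:
  assumes "classical_order_ge 3 A" "classical_order_ge n f"
    and "\<gamma> Eps = 0" "\<gamma> Hbar = 0" "wdeg \<gamma> < n + 2"
  shows "weyl_conj A f \<gamma> = f \<gamma> + weyl_ad A f \<gamma>"
proof -
  have "classical_order_ge (n + k) ((weyl_ad A ^^ k) f)" for k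
    by (induction k) (auto intro: classical_order_ge_weyl_ad assms)
  then have "(weyl_ad A ^^ k) f \<gamma> = 0" if "k \<ge> 2" for k
    using assms(3-5) that unfolding classical_order_ge_def by (meson add_left_mono order_less_le_trans)
  then have "weyl_conj A f \<gamma> = (\<Sum>k\<in>{0, 1}. (weyl_ad A ^^ k) f \<gamma> / fact k)"
    unfolding weyl_conj_def by (intro suminf_finite) auto
  then show ?thesis by simp
qed

text \<open>Degree 3 can only split as 2 + 1, so the sum runs over the variable handed to
  \<open>g\<close>.\<close>

lemma ser_mult_classical_cubic:
  assumes f: "classical_order_ge 2 f" and g: "classical_order_ge 1 g"
    and \<gamma>: "\<gamma> Eps = 0" "\<gamma> Hbar = 0" "wdeg \<gamma> = 3"
  shows "ser_mult f g \<gamma>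
    = (\<Sum>v\<in>{X1, X2, Xi1, Xi2}. if \<gamma> v = 0 then 0 else f (\<gamma>(v := \<gamma> v - 1)) * g ((\<lambda>_. 0)(v := 1)))"
proof -
  \<comment> \<open>Only variables occurring in \<open>\<gamma>\<close> count; for any other,
    truncated subtraction would give \<open>r v = \<gamma>\<close>.\<close>
  define S where "S = {v\<in>{X1, X2, Xi1, Xi2}. \<gamma> v \<noteq> 0}"
  define r where "r v = \<gamma>(v := \<gamma> v - 1)" for v
  have inj: "inj_on r S"
    unfolding inj_on_def r_def S_def by (auto simp: fun_fvar_eq_iff)
  have "ser_mult f g \<gamma> = (\<Sum>\<alpha>\<in>r ` S. f \<alpha> * g (\<lambda>v. \<gamma> v - \<alpha> v))"
    unfolding ser_mult_def
  proof (rule sum.mono_neutral_right[OF finite_exponents_le])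
    show "r ` S \<subseteq> {\<alpha>. \<alpha> \<le> \<gamma>}"
      by (auto simp: r_def le_fun_def)
    show "\<forall>\<alpha>\<in>{\<alpha>. \<alpha> \<le> \<gamma>} - r ` S. f \<alpha> * g (\<lambda>v. \<gamma> v - \<alpha> v) = 0"
    proof
      fix \<alpha> assume "\<alpha> \<in> {\<alpha>. \<alpha> \<le> \<gamma>} - r ` S"
      then have le: "\<alpha> \<le> \<gamma>" and nr: "\<alpha> \<notin> r ` S" by auto
      have le': "\<alpha> v \<le> \<gamma> v" for v using le by (simp add: le_fun_def)
      have \<alpha>: "\<alpha> Eps = 0" "\<alpha> Hbar = 0" using le'[of Eps] le'[of Hbar] \<gamma> by auto
      have "wdeg \<alpha> \<noteq> 2"
      proof
        assume "wdeg \<alpha> = 2"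
        with \<gamma> \<alpha> have sum: "\<gamma> X1 + \<gamma> X2 + \<gamma> Xi1 + \<gamma> Xi2 = Suc (\<alpha> X1 + \<alpha> X2 + \<alpha> Xi1 + \<alpha> Xi2)"
          by (simp add: wdeg_def)
        \<comment> \<open>The degrees differ by one, so \<open>\<alpha>\<close> and
          \<open>\<gamma>\<close> can differ in a single variable \<open>v\<close> only, and then
          \<open>\<alpha> = r v\<close>.\<close>
        have "\<alpha> v = \<gamma> v" if "v \<in> {X1, X2, Xi1, Xi2}" for v
        proof (rule ccontr)
          assume "\<alpha> v \<noteq> \<gamma> v"
          then have "v \<in> S" "\<alpha> = r v"
            using that sum le'[of X1] le'[of X2] le'[of Xi1] le'[of Xi2] \<alpha> \<gamma>(1,2)
            by (auto simp: S_def r_def fun_fvar_eq_iff)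
          with nr show False by blast
        qed
        with sum show False by simp
      qed
      then have "wdeg \<alpha> < 2 \<or> wdeg (\<lambda>v. \<gamma> v - \<alpha> v) < 1"
        using wdeg_diff[OF le] \<gamma> by linarith
      then show "f \<alpha> * g (\<lambda>v. \<gamma> v - \<alpha> v) = 0"
        using f g \<alpha> \<gamma> by (auto simp: classical_order_ge_def)
    qed
  qed
  also have "\<dots> = (\<Sum>v\<in>S. f (r v) * g (\<lambda>u. \<gamma> u - r v u))"
    by (simp add: sum.reindex[OF inj])
  also have "\<dots> = (\<Sum>v\<in>S. f (\<gamma>(v := \<gamma> v - 1)) * g ((\<lambda>_. 0)(v := 1)))"
  proof (rule sum.cong[OF refl])
    fix v assume "v \<in> S"
    then have "(\<lambda>u. \<gamma> u - r v u) = (\<lambda>_. 0)(v := 1)"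
      by (auto simp: r_def S_def)
    then show "f (r v) * g (\<lambda>u. \<gamma> u - r v u) = f (\<gamma>(v := \<gamma> v - 1)) * g ((\<lambda>_. 0)(v := 1))"
      by (simp add: r_def)
  qed
  also have "\<dots> = (\<Sum>v\<in>{X1, X2, Xi1, Xi2}. if v \<in> S then f (\<gamma>(v := \<gamma> v - 1)) * g ((\<lambda>_. 0)(v := 1)) else 0)"
    by (intro sum.mono_neutral_cong_left) (auto simp: S_def)
  also have "\<dots> = (\<Sum>v\<in>{X1, X2, Xi1, Xi2}. if \<gamma> v = 0 then 0 else f (\<gamma>(v := \<gamma> v - 1)) * g ((\<lambda>_. 0)(v := 1)))"
    by (intro sum.cong) (auto simp: S_def)
  finally show ?thesis .
qed

section \<open>The normal form equation in degree 3\<close>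

text \<open>Conjugation by \<open>A\<close> alters a coefficient only through terms of lower degree.
  Working upwards, \<open>H\<close> starts with \<open>H2 w\<close>, and in degree 3 a single
  bracket contributes: the homological equation.\<close>

lemma normal_form3_classical:
  assumes nf: "is_normal_form3 H w K"
  obtains A where "classical_order_ge 3 A" "classical_order_ge 2 H"
    "\<And>\<gamma>. \<gamma> Eps = 0 \<Longrightarrow> \<gamma> Hbar = 0 \<Longrightarrow> wdeg \<gamma> = 2 \<Longrightarrow> H \<gamma> = H2 w \<gamma>"
    "\<And>\<gamma>. \<gamma> Eps = 0 \<Longrightarrow> \<gamma> Hbar = 0 \<Longrightarrow> wdeg \<gamma> = 3 \<Longrightarrow> H \<gamma> - bidiff 1 A H \<gamma> = K \<gamma>"
proof -
  from nf obtain A where A3: "\<And>\<gamma>. A \<gamma> \<noteq> 0 \<Longrightarrow> 3 \<le> wdeg \<gamma>"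
    and conj: "\<And>\<gamma>. wdeg \<gamma> \<le> 3 \<Longrightarrow> weyl_conj A H \<gamma> = H2 w \<gamma> + K \<gamma>"
    and K: "\<And>\<gamma>. K \<gamma> \<noteq> 0 \<Longrightarrow> wdeg \<gamma> = 3"
    unfolding is_normal_form3_def by auto
  have A: "classical_order_ge 3 A"
    using A3 by (fastforce simp: classical_order_ge_def)
  have H2: "H2 w \<gamma> = 0" if "wdeg \<gamma> \<noteq> 2" for \<gamma>
    using that by (auto simp: H2_eq wdeg_def)
  \<comment> \<open>If \<open>H\<close> starts in the degree of \<open>\<gamma>\<close>, then
    \<open>weyl_ad A H\<close> starts one degree higher and leaves this coefficient alone.\<close>
  have step: "H \<gamma> = H2 w \<gamma>"
    if "classical_order_ge (wdeg \<gamma>) H" "wdeg \<gamma> < 3" "\<gamma> Eps = 0" "\<gamma> Hbar = 0" for \<gamma>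
  proof -
    have "weyl_ad A H \<gamma> = 0"
      using classical_order_ge_weyl_ad[OF A that(1)] that by (simp add: classical_order_ge_def)
    moreover have "K \<gamma> = 0" using K that by force
    ultimately show ?thesis
      using weyl_conj_classical[OF A that(1,3,4)] conj[of \<gamma>] that(2) by simp
  qed
  \<comment> \<open>The absence of terms of degree 0 and 1 is deduced from the normal form, climbing
    from the trivial order 0.\<close>
  have "classical_order_ge 0 H" by (simp add: classical_order_ge_def)
  moreover have Suc_order: "classical_order_ge (Suc n) H" if "classical_order_ge n H" "n < 2" for n
    unfolding classical_order_ge_def
  proof (intro allI impI)
    fix \<gamma> :: "fvar \<Rightarrow> nat"
    assume \<gamma>: "\<gamma> Eps = 0" "\<gamma> Hbar = 0" "wdeg \<gamma> < Suc n"
    show "H \<gamma> = 0"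
    proof (cases "wdeg \<gamma> = n")
      case True
      then show ?thesis using step[of \<gamma>] H2[of \<gamma>] that \<gamma> by simp
    next
      case False
      then show ?thesis using that(1) \<gamma> by (simp add: classical_order_ge_def)
    qed
  qed
  ultimately have ord: "classical_order_ge 2 H"
    by (simp add: numeral_2_eq_2)
  show ?thesis
  proof (rule that[OF A ord])
    show "H \<gamma> = H2 w \<gamma>" if "\<gamma> Eps = 0" "\<gamma> Hbar = 0" "wdeg \<gamma> = 2" for \<gamma>
      using step ord that by simp
    show "H \<gamma> - bidiff 1 A H \<gamma> = K \<gamma>" if "\<gamma> Eps = 0" "\<gamma> Hbar = 0" "wdeg \<gamma> = 3" for \<gamma>
      using weyl_conj_classical[OF A ord that(1,2)] conj[of \<gamma>] H2[of \<gamma>] that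
      by (simp add: weyl_ad_classical del: bidiff.simps)
  qed
qed

text \<open>Derivatives of \<open>A\<close> have order 2, so only the linear part of the gradient of
  \<open>H\<close> enters; it is that of \<open>H2 w\<close>, with components \<open>w_j x_j\<close>
  and \<open>w_j xi_j\<close>.\<close>

lemma bidiff_classical_cubic:
  assumes A: "classical_order_ge 3 A" and H: "classical_order_ge 2 H"
    and quad: "\<And>\<gamma>. \<gamma> Eps = 0 \<Longrightarrow> \<gamma> Hbar = 0 \<Longrightarrow> wdeg \<gamma> = 2 \<Longrightarrow> H \<gamma> = H2 w \<gamma>"
    and \<gamma>: "\<gamma> Eps = 0" "\<gamma> Hbar = 0" "wdeg \<gamma> = 3"
  shows "bidiff 1 A H \<gamma> =
      (if \<gamma> Xi1 = 0 then 0 else of_real (w $ 1) * ser_deriv X1 A (\<gamma>(Xi1 := \<gamma> Xi1 - 1)))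
    - (if \<gamma> X1 = 0 then 0 else of_real (w $ 1) * ser_deriv Xi1 A (\<gamma>(X1 := \<gamma> X1 - 1)))
    + (if \<gamma> Xi2 = 0 then 0 else of_real (w $ 2) * ser_deriv X2 A (\<gamma>(Xi2 := \<gamma> Xi2 - 1)))
    - (if \<gamma> X2 = 0 then 0 else of_real (w $ 2) * ser_deriv Xi2 A (\<gamma>(X2 := \<gamma> X2 - 1)))"
proof -
  have grad: "ser_deriv u H ((\<lambda>_. 0)(v := 1))
      = (if u = v then of_real (w $ (if v \<in> {X1, Xi1} then 1 else 2)) else 0)"
    if "u \<in> {X1, X2, Xi1, Xi2}" "v \<in> {X1, X2, Xi1, Xi2}" for u v
    using that by (auto simp: ser_deriv_def quad wdeg_def H2_eq fun_fvar_eq_iff)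
  have "ser_mult (ser_deriv u A) (ser_deriv v H) \<gamma>
      = (if \<gamma> v = 0 then 0 else of_real (w $ (if v \<in> {X1, Xi1} then 1 else 2)) * ser_deriv u A (\<gamma>(v := \<gamma> v - 1)))"
    if "u \<in> {X1, X2, Xi1, Xi2}" "v \<in> {X1, X2, Xi1, Xi2}" for u v
  proof -
    have "classical_order_ge 2 (ser_deriv u A)" "classical_order_ge 1 (ser_deriv v H)"
      using classical_order_ge_deriv[OF A that(1)] classical_order_ge_deriv[OF H that(2)] by simp_all
    note ser_mult_classical_cubic[OF this \<gamma>]
    also have "(\<Sum>x\<in>{X1, X2, Xi1, Xi2}. if \<gamma> x = 0 then 0
          else ser_deriv u A (\<gamma>(x := \<gamma> x - 1)) * ser_deriv v H ((\<lambda>_. 0)(x := 1)))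
        = (\<Sum>x\<in>{X1, X2, Xi1, Xi2}. if x = v then if \<gamma> v = 0 then 0
          else of_real (w $ (if v \<in> {X1, Xi1} then 1 else 2)) * ser_deriv u A (\<gamma>(v := \<gamma> v - 1)) else 0)"
      by (intro sum.cong refl) (simp only: grad that(2), simp)
    also have "\<dots> = (if \<gamma> v = 0 then 0
        else of_real (w $ (if v \<in> {X1, Xi1} then 1 else 2)) * ser_deriv u A (\<gamma>(v := \<gamma> v - 1)))"
      using that(2) by (subst sum.delta) simp_all
    finally show ?thesis .
  qed
  then show ?thesis by simp
qed

text \<open>
  The left-hand side is 8 times the real part of the coefficient of \<open>z\<^sub>1\<^sup>2 cnj z\<^sub>2\<close> in \<open>H\<close>.
\<close>

lemma normal_form3_resonant_coefficient:
  assumes nf: "is_normal_form3 H w (K3 \<nu>1 \<nu>2 \<mu>)" and res: "w $ 2 = 2 * w $ 1"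
  shows "H (case_fvar 2 1 0 0 0 0) - H (case_fvar 0 1 2 0 0 0) + H (case_fvar 1 0 1 1 0 0) = 4 * of_real \<mu>"
proof -
  obtain A where A: "classical_order_ge 3 A" and H: "classical_order_ge 2 H"
    and quad: "\<And>\<gamma>. \<gamma> Eps = 0 \<Longrightarrow> \<gamma> Hbar = 0 \<Longrightarrow> wdeg \<gamma> = 2 \<Longrightarrow> H \<gamma> = H2 w \<gamma>"
    and cubic: "\<And>\<gamma>. \<gamma> Eps = 0 \<Longrightarrow> \<gamma> Hbar = 0 \<Longrightarrow> wdeg \<gamma> = 3 \<Longrightarrow> H \<gamma> - bidiff 1 A H \<gamma> = K3 \<nu>1 \<nu>2 \<mu> \<gamma>"
    using normal_form3_classical[OF nf] by metis
  note B = bidiff_classical_cubic[OF A H quad]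
  have upd: "(case_fvar a b c d e h)(X1 := k) = case_fvar k b c d e h"
    "(case_fvar a b c d e h)(X2 := k) = case_fvar a k c d e h"
    "(case_fvar a b c d e h)(Xi1 := k) = case_fvar a b k d e h"
    "(case_fvar a b c d e h)(Xi2 := k) = case_fvar a b c k e h" for a b c d e h k :: nat
    by (simp_all add: fun_fvar_eq_iff)
  have b1: "bidiff 1 A H (case_fvar 2 1 0 0 0 0)
      = - of_real (w $ 1) * A (case_fvar 1 1 1 0 0 0) - of_real (w $ 2) * A (case_fvar 2 0 0 1 0 0)"
    by (subst B) (simp_all add: wdeg_def ser_deriv_def upd numeral_2_eq_2)
  have b2: "bidiff 1 A H (case_fvar 0 1 2 0 0 0)
      = of_real (w $ 1) * A (case_fvar 1 1 1 0 0 0) - of_real (w $ 2) * A (case_fvar 0 0 2 1 0 0)"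
    by (subst B) (simp_all add: wdeg_def ser_deriv_def upd numeral_2_eq_2)
  have b3: "bidiff 1 A H (case_fvar 1 0 1 1 0 0)
      = 2 * of_real (w $ 1) * A (case_fvar 2 0 0 1 0 0) - 2 * of_real (w $ 1) * A (case_fvar 0 0 2 1 0 0)
        + of_real (w $ 2) * A (case_fvar 1 1 1 0 0 0)"
    by (subst B) (simp_all add: wdeg_def ser_deriv_def upd numeral_2_eq_2)
  have H_eq: "H \<gamma> = K3 \<nu>1 \<nu>2 \<mu> \<gamma> + bidiff 1 A H \<gamma>" if "\<gamma> Eps = 0" "\<gamma> Hbar = 0" "wdeg \<gamma> = 3" for \<gamma>
    using cubic[OF that] by (simp add: algebra_simps del: bidiff.simps)
  \<comment> \<open>In the combination of the three brackets every coefficient of \<open>A\<close>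
    is multiplied by plus or minus \<open>w $ 2 - 2 * w $ 1\<close>, which is zero by
    \<open>res\<close>; \<open>K3\<close> contributes 1 + 1 + 2 times \<open>\<mu>\<close>.\<close>
  show ?thesis
    by (simp add: H_eq b1 b2 b3 K3_cubic_coefficients wdeg_def res algebra_simps del: bidiff.simps One_nat_def)
qed

section \<open>The reduced symbol\<close>

lemma deriv_add_const: "deriv (\<lambda>x. g x + k) = deriv g" for g :: "real \<Rightarrow> real"
  unfolding deriv_def DERIV_def by simp

lemma reduced_symbol_0:
  assumes "m 0 = 0" and "V 0 0 = 0"
  shows "reduced_symbol V m U \<omega> 0 y \<eta> = (norm (U 0 *v (\<chi> j. sqrt (\<omega> 0 $ j) * \<eta> $ j)))\<^sup>2 / 2
    + V 0 (y $ 1 *\<^sub>R ((1 / sqrt (\<omega> 0 $ 1)) *\<^sub>R column 1 (U 0))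
         + y $ 2 *\<^sub>R ((1 / sqrt (\<omega> 0 $ 2)) *\<^sub>R column 2 (U 0)))"
proof -
  have "U 0 *v (\<chi> j. y $ j / sqrt (\<omega> 0 $ j))
    = y $ 1 *\<^sub>R ((1 / sqrt (\<omega> 0 $ 1)) *\<^sub>R column 1 (U 0))
      + y $ 2 *\<^sub>R ((1 / sqrt (\<omega> 0 $ 2)) *\<^sub>R column 2 (U 0))"
    by (simp add: vec_eq_iff matrix_vector_mult_def column_def sum_2 mult.commute)
  then show ?thesis
    using assms by (simp add: reduced_symbol_def schroedinger_symbol_def)
qed

text \<open>The kinetic energy depends on \<open>\<xi>\<close> only and the potential on
  \<open>x\<close> only, so mixed coefficients vanish; the division by 2 is the Taylor factor of
  \<open>x1^2 x2\<close>.\<close>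

lemma reduced_symbol_resonant_coefficients:
  fixes V U \<omega>
  assumes "m 0 = 0" and "V 0 0 = 0"
  defines "u \<equiv> (1 / sqrt (\<omega> 0 $ 1)) *\<^sub>R column 1 (U 0)" and "v \<equiv> (1 / sqrt (\<omega> 0 $ 2)) *\<^sub>R column 2 (U 0)"
    and "H \<equiv> taylor_series (reduced_symbol V m U \<omega>)"
  shows "H (case_fvar 2 1 0 0 0 0) = of_real (deriv (deriv (\<lambda>s. deriv (\<lambda>t. V 0 (s *\<^sub>R u + t *\<^sub>R v)) 0)) 0 / 2)"
    and "H (case_fvar 0 1 2 0 0 0) = 0"
    and "H (case_fvar 1 0 1 1 0 0) = 0"
proof -
  note R = reduced_symbol_0[of m V U \<omega>, OF assms(1,2), folded u_def v_def]
  have "(\<chi> j. sqrt (\<omega> 0 $ j) * vector [0, 0] $ j) = (0 :: real^2)"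
    by (simp add: vec_eq_iff forall_2)
  then show "H (case_fvar 2 1 0 0 0 0) = of_real (deriv (deriv (\<lambda>s. deriv (\<lambda>t. V 0 (s *\<^sub>R u + t *\<^sub>R v)) 0)) 0 / 2)"
    by (simp add: H_def taylor_series_def R numeral_2_eq_2)
  show "H (case_fvar 0 1 2 0 0 0) = 0" "H (case_fvar 1 0 1 1 0 0) = 0"
    by (simp_all add: H_def taylor_series_def R deriv_add_const numeral_2_eq_2)
qed

section \<open>Spectral decomposition of the Hessian at \<open>\<epsilon> = 0\<close>\<close>

text \<open>A bound by a multiple of \<open>\<epsilon>\<close> that holds at
  \<open>\<epsilon> = 0\<close> itself forces the error to vanish there.\<close>

lemma diagonalizes_0:
  assumes fam: "potential_family \<epsilon>0 V m" and diag: "diagonalizes \<epsilon>0 V m U \<omega>"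
  shows "orthogonal_matrix (U 0)" and "0 < \<omega> 0 $ j"
    and "hessian (V 0) 0 = U 0 ** (\<chi> i j. if i = j then (\<omega> 0 $ i)\<^sup>2 else 0) ** transpose (U 0)"
proof -
  define D :: "real^2^2" where "D = (\<chi> i j. if i = j then (\<omega> 0 $ i)\<^sup>2 else 0)"
  have "0 < \<epsilon>0" and m0: "m 0 = 0"
    using fam by (auto simp: potential_family_def)
  then show orth: "orthogonal_matrix (U 0)" and "0 < \<omega> 0 $ j"
    using diag by (auto simp: diagonalizes_def)
  have "(transpose (U 0) ** hessian (V 0) 0 ** U 0) $ i $ j = D $ i $ j" for i j
  proof -
    have "(\<lambda>\<epsilon>. (transpose (U \<epsilon>) ** hessian (V \<epsilon>) (m \<epsilon>) ** U \<epsilon>) $ i $ j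
        - (if i = j then (\<omega> \<epsilon> $ i)\<^sup>2 else 0)) \<in> O[nhds 0](\<lambda>\<epsilon>. \<epsilon> ^ 1)"
      using diag unfolding diagonalizes_def by blast
    then obtain C where "eventually (\<lambda>\<epsilon>. norm ((transpose (U \<epsilon>) ** hessian (V \<epsilon>) (m \<epsilon>) ** U \<epsilon>) $ i $ j
        - (if i = j then (\<omega> \<epsilon> $ i)\<^sup>2 else 0)) \<le> C * norm (\<epsilon> ^ 1)) (nhds 0)"
      by (elim landau_o.bigE)
    from eventually_nhds_x_imp_x[OF this] show ?thesis
      by (simp add: m0 D_def)
  qed
  then have "D = transpose (U 0) ** hessian (V 0) 0 ** U 0"
    by (simp add: vec_eq_iff)
  then have "U 0 ** D ** transpose (U 0)
      = (U 0 ** transpose (U 0)) ** hessian (V 0) 0 ** (U 0 ** transpose (U 0))"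
    by (simp add: matrix_mul_assoc)
  also have "\<dots> = hessian (V 0) 0"
    using orth by (simp add: orthogonal_matrix_def)
  finally show "hessian (V 0) 0 = U 0 ** (\<chi> i j. if i = j then (\<omega> 0 $ i)\<^sup>2 else 0) ** transpose (U 0)"
    by (simp add: D_def)
qed

text \<open>The second column fixes the first only up to sign, so only quadratic expressions in the
  first column are recovered.\<close>

lemma orthogonal_matrix_2:
  fixes U :: "real^2^2"
  assumes "orthogonal_matrix U"
  shows "(U $ 1 $ 2)\<^sup>2 + (U $ 2 $ 2)\<^sup>2 = 1" and "(U $ 1 $ 1)\<^sup>2 = (U $ 2 $ 2)\<^sup>2"
    and "(U $ 2 $ 1)\<^sup>2 = (U $ 1 $ 2)\<^sup>2" and "U $ 1 $ 1 * U $ 2 $ 1 = - (U $ 1 $ 2 * U $ 2 $ 2)"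
proof -
  have "(transpose U ** U) $ i $ j = mat 1 $ i $ j" "(U ** transpose U) $ i $ j = mat 1 $ i $ j" for i j
    using assms by (simp_all add: orthogonal_matrix_def)
  from this(1)[of 2 2] this(2)[of 1 1] this(2)[of 2 2] this(2)[of 1 2]
  show "(U $ 1 $ 2)\<^sup>2 + (U $ 2 $ 2)\<^sup>2 = 1" and "(U $ 1 $ 1)\<^sup>2 = (U $ 2 $ 2)\<^sup>2"
    and "(U $ 2 $ 1)\<^sup>2 = (U $ 1 $ 2)\<^sup>2" and "U $ 1 $ 1 * U $ 2 $ 1 = - (U $ 1 $ 2 * U $ 2 $ 2)"
    by (simp_all add: matrix_matrix_mult_def transpose_def mat_def sum_2 power2_eq_square)
qed

text \<open>Signs need care: negating the second column of \<open>U\<close> is allowed and negates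
  \<open>\<mu>\<close>, and the ratio of the entries of that column has the sign of
  \<open>b\<close>, whereas \<open>z\<close> contains \<open>\<bar>b\<bar>\<close>. For
  \<open>d = 0\<close> that column lies on the first axis and the ratio is undefined.\<close>

theorem theorem3p6:
  fixes V :: "real \<Rightarrow> real^2 \<Rightarrow> real" and m :: "real \<Rightarrow> real^2"
    and U :: "real \<Rightarrow> real^2^2" and \<omega> :: "real \<Rightarrow> real^2"
    and \<epsilon>0 \<mu> a b c d z :: real
  assumes family: "potential_family \<epsilon>0 V m"
    and V00: "V 0 0 = 0"
    and gradient: "(V 0 has_derivative (\<lambda>_. 0)) (at 0)"
    and reduction: "diagonalizes \<epsilon>0 V m U \<omega>"
    and Fermi_resonance: "\<omega> 0 $ 2 = 2 * \<omega> 0 $ 1"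
    and normal_form: "is_normal_form3 (taylor_series (reduced_symbol V m U \<omega>)) (\<omega> 0)
          (K3 (deriv (\<lambda>\<epsilon>. \<omega> \<epsilon> $ 1) 0) (deriv (\<lambda>\<epsilon>. \<omega> \<epsilon> $ 2) 0) \<mu>)"
    and a: "a = pd 1 (pd 1 (V 0)) 0"
    and b: "b = pd 1 (pd 2 (V 0)) 0"
    and c: "c = pd 2 (pd 2 (V 0)) 0"
    and d: "d = 3 * (\<omega> 0 $ 1)\<^sup>2 - a + c"
    and z: "z = 2 * \<bar>b\<bar> / d"
  shows "\<omega> 0 $ 1 = 1 / sqrt 3 * ((a - c)\<^sup>2 + 4 * b\<^sup>2) powr (1/4) \<and>
    (d \<noteq> 0 \<longrightarrow>
       U 0 $ 2 $ 2 \<noteq> 0 \<and>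
       (0 \<le> b \<longrightarrow> \<mu> = sgn (U 0 $ 2 $ 2) * mu_formula (V 0) (\<omega> 0 $ 1) z) \<and>
       (b < 0 \<longrightarrow> \<mu> = sgn (U 0 $ 2 $ 2) * mu_formula (V 0) (\<omega> 0 $ 1) (- z)))"
proof -
  define w where "w = \<omega> 0 $ 1"
  define q s where "q = U 0 $ 1 $ 2" and "s = U 0 $ 2 $ 2"
  have w: "0 < w" and w2: "\<omega> 0 $ 2 = 2 * w"
    using diagonalizes_0(2)[OF family reduction] Fermi_resonance by (simp_all add: w_def)
  note U = orthogonal_matrix_2[OF diagonalizes_0(1)[OF family reduction], folded q_def s_def]
  note M = diagonalizes_0(3)[OF family reduction]
  \<comment> \<open>The entries of the spectral decomposition, with eigenvalues \<open>w^2\<close>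
    and \<open>4 w^2\<close>, express \<open>a\<close>, \<open>b\<close>, \<open>c\<close> by the
    second column \<open>(q, s)\<close>.\<close>
  have "a = (U 0 $ 1 $ 1)\<^sup>2 * w\<^sup>2 + q\<^sup>2 * (2 * w)\<^sup>2"
    using arg_cong[OF M, of "\<lambda>M. M $ 1 $ 1"]
    by (simp add: a hessian_def matrix_matrix_mult_def transpose_def sum_2 w2 w_def[symmetric]
        q_def power2_eq_square)
  then have a_eq: "a = w\<^sup>2 * (s\<^sup>2 + 4 * q\<^sup>2)"
    by (simp add: U algebra_simps)
  have "c = (U 0 $ 2 $ 1)\<^sup>2 * w\<^sup>2 + s\<^sup>2 * (2 * w)\<^sup>2"
    using arg_cong[OF M, of "\<lambda>M. M $ 2 $ 2"]
    by (simp add: c hessian_def matrix_matrix_mult_def transpose_def sum_2 w2 w_def[symmetric]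
        s_def power2_eq_square)
  then have c_eq: "c = w\<^sup>2 * (q\<^sup>2 + 4 * s\<^sup>2)"
    by (simp add: U algebra_simps)
  have "b = (U 0 $ 1 $ 1 * U 0 $ 2 $ 1) * w\<^sup>2 + q * s * (2 * w)\<^sup>2"
    using arg_cong[OF M, of "\<lambda>M. M $ 1 $ 2"]
    by (simp add: b hessian_def matrix_matrix_mult_def transpose_def sum_2 w2 w_def[symmetric]
        q_def s_def power2_eq_square)
  then have b_eq: "b = 3 * w\<^sup>2 * q * s"
    by (simp add: U algebra_simps)
  \<comment> \<open>Inserting \<open>q^2 + s^2 = 1\<close> makes \<open>d\<close> a quadratic form
    in which \<open>q\<close> cancels.\<close>
  have "d = 3 * w\<^sup>2 * (q\<^sup>2 + s\<^sup>2) - a + c"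
    by (simp add: d w_def U)
  then have d_eq: "d = 6 * w\<^sup>2 * s\<^sup>2"
    by (simp add: a_eq c_eq algebra_simps)

  \<comment> \<open>The discriminant of the Hessian is the square of the eigenvalue gap
    \<open>4 w^2 - w^2\<close>.\<close>
  have "(a - c)\<^sup>2 + 4 * b\<^sup>2 = (3 * w\<^sup>2 * (q\<^sup>2 + s\<^sup>2))\<^sup>2"
    unfolding a_eq b_eq c_eq by algebra
  also have "\<dots> = (sqrt 3 * w) ^ 4"
    unfolding U(1) by (simp add: power4_eq_xxxx power2_eq_square)
  also have "\<dots> = (sqrt 3 * w) powr 4"
    using w by (simp add: powr_realpow flip: powr_numeral)
  finally have "((a - c)\<^sup>2 + 4 * b\<^sup>2) powr (1/4) = (sqrt 3 * w) powr (4 * (1/4))"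
    by (simp only: powr_powr)
  also have "\<dots> = sqrt 3 * w"
    using w by simp
  finally have "((a - c)\<^sup>2 + 4 * b\<^sup>2) powr (1/4) = sqrt 3 * w" .
  then have frequency: "w = 1 / sqrt 3 * ((a - c)\<^sup>2 + 4 * b\<^sup>2) powr (1/4)"
    by simp

  have m0: "m 0 = 0" and "0 < \<epsilon>0"
    and smooth: "smooth_on ({-\<epsilon>0<..<\<epsilon>0} \<times> UNIV) (\<lambda>(\<epsilon>, x). V \<epsilon> x)"
    using family by (auto simp: potential_family_def)
  have C3: "Ck_on 3 UNIV (V 0)"
    using Ck_on_slice[of 3 "{-\<epsilon>0<..<\<epsilon>0}" "\<lambda>(\<epsilon>, x). V \<epsilon> x" 0] smooth \<open>0 < \<epsilon>0\<close>
    by (simp add: smooth_on_def)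
  define u v where "u = (1 / sqrt w) *\<^sub>R column 1 (U 0)" and "v = (1 / sqrt (2 * w)) *\<^sub>R column 2 (U 0)"
  \<comment> \<open>The normal form gives \<open>4 \<mu>\<close> for the coefficient of
    \<open>x1^2 x2\<close>, which is half the third derivative.\<close>
  have "complex_of_real (8 * \<mu>) = of_real (deriv (deriv (\<lambda>s. deriv (\<lambda>t. V 0 (s *\<^sub>R u + t *\<^sub>R v)) 0)) 0)"
    using normal_form3_resonant_coefficient[OF normal_form Fermi_resonance]
      reduced_symbol_resonant_coefficients[where m = m and V = V and U = U and \<omega> = \<omega>, OF m0 V00]
    by (simp add: w2 w_def[symmetric] u_def v_def)
  then have "8 * \<mu> = deriv (deriv (\<lambda>s. deriv (\<lambda>t. V 0 (s *\<^sub>R u + t *\<^sub>R v)) 0)) 0"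
    by (simp only: of_real_eq_iff)
  note mu8 = this[unfolded third_derivative_along_lines[OF C3]]
  have \<mu>: "\<mu> = sgn s * mu_formula (V 0) w (q / s)" if "s \<noteq> 0"
  proof -
    define h where "h = sqrt (2 * w)"
    \<comment> \<open>The scaling: two factors \<open>sqrt w\<close> from \<open>u\<close> and one
      \<open>sqrt (2 * w)\<close> from \<open>v\<close>.\<close>
    define N where "N = w * h"
    define T where "T = q / s * pd 1 (pd 1 (pd 1 (V 0))) 0
        + (1 - 2 * (q / s)\<^sup>2) * pd 1 (pd 1 (pd 2 (V 0))) 0
        + ((q / s) ^ 3 - 2 * (q / s)) * pd 1 (pd 2 (pd 2 (V 0))) 0 + (q / s)\<^sup>2 * pd 2 (pd 2 (pd 2 (V 0))) 0"
    have h: "h \<noteq> 0" and N: "N \<noteq> 0"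
      using w by (simp_all add: h_def N_def)
    \<comment> \<open>As \<open>u\<close> enters quadratically, the unknown sign of the first column
      drops out.\<close>
    have u: "(u $ 1)\<^sup>2 = s\<^sup>2 / w" "(u $ 2)\<^sup>2 = q\<^sup>2 / w" "u $ 1 * u $ 2 = - (q * s) / w"
      using w U by (simp_all add: u_def column_def power_divide)
    have v: "v $ 1 = q / h" "v $ 2 = s / h"
      by (simp_all add: v_def h_def column_def q_def s_def)
    have "8 * \<mu> = (s\<^sup>2 * q * pd 1 (pd 1 (pd 1 (V 0))) 0 + (s ^ 3 - 2 * q\<^sup>2 * s) * pd 1 (pd 1 (pd 2 (V 0))) 0
        + (q ^ 3 - 2 * q * s\<^sup>2) * pd 1 (pd 2 (pd 2 (V 0))) 0 + q\<^sup>2 * s * pd 2 (pd 2 (pd 2 (V 0))) 0) / N"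
      unfolding mu8 mult.assoc[of 2 "u $ 1"] u v N_def using w h
      by (simp add: field_simps power2_eq_square power3_eq_cube)
    \<comment> \<open>The numerator is homogeneous of degree 3 in \<open>(q, s)\<close>, so
      \<open>s ^ 3\<close> times a polynomial in \<open>q / s\<close>.\<close>
    also have "\<dots> = s ^ 3 / N * T"
      using that N by (simp add: T_def field_simps power2_eq_square power3_eq_cube)
    finally have *: "8 * \<mu> = s ^ 3 / N * T" .
    have powr32: "x powr (3/2) = x * sqrt x" if "0 < x" for x :: real
      using that powr_add[of x 1 "1/2"] by (simp add: powr_half_sqrt)
    have "1 + (q / s)\<^sup>2 = 1 / s\<^sup>2"
      using that U(1) by (simp add: field_simps)
    then have scale: "(1 + (q / s)\<^sup>2) powr (3/2) = 1 / \<bar>s\<bar> ^ 3"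
      using that powr32[of "1 / s\<^sup>2"]
      by (simp add: real_sqrt_divide power3_eq_cube) (simp add: power2_eq_square)
    \<comment> \<open>The power of \<open>1 + (q / s)^2\<close> yields only the absolute value of
      \<open>s\<close>; the remaining sign is the factor \<open>sgn s\<close>.\<close>
    have s3: "s ^ 3 = sgn s * \<bar>s\<bar> ^ 3"
      by (simp add: sgn_if)
    have N_eq: "N = sqrt 2 * w powr (3/2)"
      using w by (simp add: N_def h_def powr32 real_sqrt_mult)
    show ?thesis
      using * w unfolding mu_formula_def T_def[symmetric] scale s3 N_eq by (simp add: field_simps)
  qed
  \<comment> \<open>The common factor \<open>6 w^2 s\<close> cancels in
    \<open>2 * b / d\<close>.\<close>
  have "s \<noteq> 0" and "2 * b / d = q / s" if "d \<noteq> 0"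
    using that w by (auto simp: d_eq b_eq power2_eq_square)
  moreover have "2 * b / d = (if b < 0 then - z else z)"
    by (simp add: z)
  ultimately show ?thesis
    using frequency \<mu> unfolding w_def[symmetric] s_def[symmetric] by (auto split: if_splits)
qed

end
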